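(* Let $0<\alpha<1$, $\beta>0$, $\mu>0$, let $\mathcal{E}$ be a Gaussian white noise on $\mathbb{R}$ with intensity $\sigma^2$, and let $$X(t)=\frac{1}{\Gamma(\beta)}\int_0^\infty dz\int_0^\infty ds\; s^{\beta-1}e^{-s\mu}\,h_\alpha(z,s)\,\mathcal{E}(t+z).$$ Then the spectral density $f(\tau)=\int_{-\infty}^{+\infty}e^{i\tau h}\,\mathrm{Cov}_X(h)\,dh$ of $X$ is $$f(\tau)=\frac{\sigma^2}{\left(\mu^2+2|\tau|^\alpha\mu\cos\frac{\pi\alpha}{2}+|\tau|^{2\alpha}\right)^\beta},\qquad \tau\in\mathbb{R}.$$
   Context: Stable subordinator density: $h_\alpha(z,s)$, $z,s\ge 0$, is the probability density in $z$ of the positively skewed stable process (stable subordinator) of order $\alpha\in(0,1)$ at time $s$, i.e. $\int_0^\infty e^{-\xi z}h_\alpha(z,s)\,dz=e^{-s\xi^\alpha}$ for $\xi\ge 0$. White noise: $\mathcal{E}$ is a centered Gaussian linear family $\{\mathcal{E}(\varphi):\varphi\in L^2(\mathbb{R})\}$ with $\mathbb{E}[\mathcal{E}(\varphi)\mathcal{E}(\psi)]=\sigma^2\int_{\mathbb{R}}\varphi\psi\,dt$; formally $\mathcal{E}(\varphi)=\int\varphi(t)\mathcal{E}(t)dt$ and $\mathbb{E}\,\mathcal{E}(t)\mathcal{E}(s)=\sigma^2\delta(t-s)$. For a kernel $K\in L^1(\mathbb{R})$, the expression $X(t)=\int K(x)\mathcal{E}(t+x)\,dx$ denotes the generalized process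 $X(\varphi)=\mathcal{E}(K*\varphi)$, $\varphi\in L^2(\mathbb{R})$. In an iterated integral such as the one in the claim, $K$ is the function obtained by carrying out the other integration ($K(z)=0$ for $z<0$). Covariance function: $\mathrm{Cov}_X(h)=\mathbb{E}[X(t+h)X(t)]$, where $\mathbb{E}X(t)=0$. For generalized processes this means that $\mathrm{Cov}_X$ is the integrable function on $\mathbb{R}$ with $\mathbb{E}[X(\varphi)X(\psi)]=\int\int\mathrm{Cov}_X(t-s)\varphi(t)\psi(s)\,dt\,ds$ for all $\varphi,\psi\in L^2(\mathbb{R})$. *)

theory Defs
  imports "HOL-Probability.Probability"
begin

text \<open>
  Elements of \<open>L\<^sup>2(\<real>)\<close> are represented by Borel functions; a.e. equality is not quotiented out.
\<close>
definition L2_real :: "(real \<Rightarrow> real) set" where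
  "L2_real = {\<phi>. \<phi> \<in> borel_measurable lborel \<and> integrable lborel (\<lambda>t. (\<phi> t)\<^sup>2)}"

text \<open>
  The case \<open>\<xi> = 0\<close> of the Laplace identity gives total mass 1, and its positive right-hand side
  forces integrability (the integral of a non-integrable function is 0).
  Time \<open>s = 0\<close> is excluded, since the law at time 0 is the unit mass at 0 and has no density.
  A density is determined by its Laplace transform only up to a \<open>z\<close>-null set for each single \<open>s\<close>;
  any choice that is jointly Borel on \<open>z \<ge> 0\<close>, \<open>s > 0\<close> (such as the continuous one) is admitted.
\<close>
definition stable_subordinator_density :: "real \<Rightarrow> (real \<Rightarrow> real \<Rightarrow> real) \<Rightarrow> bool" where
  "stable_subordinator_density \<alpha> h \<longleftrightarrow>
     (\<lambda>(z, s). h z s) \<in> borel_measurable (restrict_space borel ({0..} \<times> {0<..})) \<and>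
     (\<forall>z\<ge>0. \<forall>s>0. h z s \<ge> 0) \<and>
     (\<forall>s>0. \<forall>\<xi>\<ge>0. (LBINT z:{0..}. exp (- \<xi> * z) * h z s) = exp (- s * \<xi> powr \<alpha>))"

text \<open>A constant counts as a (degenerate) Gaussian variable.\<close>
definition gaussian_rv :: "'w measure \<Rightarrow> ('w \<Rightarrow> real) \<Rightarrow> bool" where
  "gaussian_rv M Y \<longleftrightarrow> Y \<in> borel_measurable M \<and>
     ((\<exists>m. AE \<omega> in M. Y \<omega> = m) \<or>
      (\<exists>m v. v > 0 \<and> distributed M lborel Y (normal_density m v)))"

definition gaussian_family :: "'w measure \<Rightarrow> 'i set \<Rightarrow> ('i \<Rightarrow> 'w \<Rightarrow> real) \<Rightarrow> bool" where
  "gaussian_family M I Y \<longleftrightarrow>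
     (\<forall>J c. finite J \<and> J \<subseteq> I \<longrightarrow> gaussian_rv M (\<lambda>\<omega>. \<Sum>j\<in>J. c j * Y j \<omega>))"

definition white_noise :: "'w measure \<Rightarrow> real \<Rightarrow> ((real \<Rightarrow> real) \<Rightarrow> 'w \<Rightarrow> real) \<Rightarrow> bool" where
  "white_noise M \<sigma> W \<longleftrightarrow>
     prob_space M \<and>
     gaussian_family M L2_real W \<and>
     (\<forall>\<phi>\<in>L2_real. (LINT \<omega>|M. W \<phi> \<omega>) = 0) \<and>
     (\<forall>\<phi>\<in>L2_real. \<forall>\<psi>\<in>L2_real. \<forall>a b.
        AE \<omega> in M. W (\<lambda>t. a * \<phi> t + b * \<psi> t) \<omega> = a * W \<phi> \<omega> + b * W \<psi> \<omega>) \<and>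
     (\<forall>\<phi>\<in>L2_real. \<forall>\<psi>\<in>L2_real.
        (LINT \<omega>|M. W \<phi> \<omega> * W \<psi> \<omega>) = \<sigma>\<^sup>2 * (LBINT t. \<phi> t * \<psi> t))"

definition convol :: "(real \<Rightarrow> real) \<Rightarrow> (real \<Rightarrow> real) \<Rightarrow> real \<Rightarrow> real" where
  "convol K \<phi> u = (LBINT x. K x * \<phi> (u - x))"

text \<open>
  The generalized process written formally as \<open>X(t) = \<integral> K(x) W(t + x) dx\<close>.
\<close>
definition moving_average ::
    "((real \<Rightarrow> real) \<Rightarrow> 'w \<Rightarrow> real) \<Rightarrow> (real \<Rightarrow> real) \<Rightarrow> (real \<Rightarrow> real) \<Rightarrow> 'w \<Rightarrow> real" where
  "moving_average W K \<phi> = W (convol K \<phi>)"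

definition subordinated_kernel :: "(real \<Rightarrow> real \<Rightarrow> real) \<Rightarrow> real \<Rightarrow> real \<Rightarrow> real \<Rightarrow> real" where
  "subordinated_kernel h \<beta> \<mu> z =
     (if z < 0 then 0
      else 1 / Gamma \<beta> * (LBINT s:{0<..}. s powr (\<beta> - 1) * exp (- s * \<mu>) * h z s))"

text \<open>
  Square integrability makes the mean and the second moments below genuine expectations.
  A covariance function is unique up to a null set.
\<close>
definition is_covariance_function ::
    "'w measure \<Rightarrow> ((real \<Rightarrow> real) \<Rightarrow> 'w \<Rightarrow> real) \<Rightarrow> (real \<Rightarrow> real) \<Rightarrow> bool" where
  "is_covariance_function M X C \<longleftrightarrow>
     (\<forall>\<phi>\<in>L2_real. X \<phi> \<in> borel_measurable M \<and> integrable M (\<lambda>\<omega>. (X \<phi> \<omega>)\<^sup>2) \<and>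
        (LINT \<omega>|M. X \<phi> \<omega>) = 0) \<and>
     integrable lborel C \<and>
     (\<forall>\<phi>\<in>L2_real. \<forall>\<psi>\<in>L2_real.
        (LINT \<omega>|M. X \<phi> \<omega> * X \<psi> \<omega>) = (LBINT s. LBINT t. C (t - s) * \<phi> t * \<psi> s))"

definition spectral_density_of :: "(real \<Rightarrow> real) \<Rightarrow> real \<Rightarrow> complex" where
  "spectral_density_of C \<tau> = (LBINT h. exp (\<i> * of_real (\<tau> * h)) * of_real (C h))"

end

theory Submission
  imports Defs "HOL-Complex_Analysis.Conformal_Mappings"
begin

text \<open>
  Why the theorem holds. Write \<open>\<phi> \<star> \<psi>\<close> for the cross correlation
  \<open>h \<mapsto> \<integral> \<phi>(s + h) \<psi>(s) ds\<close>. Both ways of computing a second moment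
  \<open>E[X(\<phi>) X(\<psi>)]\<close> reduce to an integral against \<open>\<phi> \<star> \<psi>\<close>. The isometry of the white
  noise and Fubini give \<open>\<sigma>\<^sup>2 \<integral> A(h) (\<phi> \<star> \<psi>)(h) dh\<close>, where \<open>A\<close> is the autocorrelation of the
  kernel \<open>K\<close> (\<open>integral_convol_mult_convol\<close>). A covariance function \<open>C\<close> gives
  \<open>\<integral> C(h) (\<phi> \<star> \<psi>)(h) dh\<close> (\<open>covariance_form_eq_cross_correlation\<close>). Hence \<open>\<sigma>\<^sup>2 A\<close> is a covariance
  function, and any other one differs from it by an integrable function orthogonal to all cross
  correlations. Truncated waves on \<open>[0, n]\<close> have cross correlations that, after division by \<open>n\<close>, tend
  to \<open>cos(\<tau>h)\<close> and \<open>sin(\<tau>h)\<close>, so such a difference has Fourier transform zero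
  (\<open>fourier_eq_0_if_orthogonal_to_cross_correlations\<close>).
  The spectral density is therefore \<open>\<sigma>\<^sup>2\<close> times the Fourier transform of \<open>A\<close>, which is the squared
  modulus of the Fourier transform of \<open>K\<close>.

  It remains to compute that modulus. On the positive real axis the Laplace transform of \<open>K\<close> is a
  mixture of \<open>exp(-s \<xi>\<^sup>\<alpha>)\<close> with Gamma weights, hence equals \<open>(\<mu> + \<xi>\<^sup>\<alpha>)\<close> to the power
  \<open>-\<beta>\<close> (\<open>subordinated_kernel_laplace\<close>). Both sides are holomorphic in the open right half-plane and
  continuous up to the imaginary axis away from \<open>0\<close>, so the identity extends to \<open>\<xi> = -i\<tau>\<close>
  (\<open>laplace_transform_eq_powr_if_eq_on_reals\<close>), where the Laplace transform is the Fourier transform.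
  Finally \<open>(-i\<tau>)\<^sup>\<alpha>\<close> has modulus \<open>\<bar>\<tau>\<bar>\<^sup>\<alpha>\<close> and argument \<open>\<plusminus>\<pi>\<alpha>/2\<close>, and the law of cosines yields
  the denominator in the claim.
\<close>

section \<open>Cross correlations of square-integrable functions\<close>

lemma L2_real_measurable: "\<phi> \<in> L2_real \<Longrightarrow> \<phi> \<in> borel_measurable borel"
  by (simp add: L2_real_def)

lemma abs_mult_le_sum_squares: "\<bar>a * b\<bar> \<le> a\<^sup>2 + b\<^sup>2" for a b :: real
proof -
  have "0 \<le> (\<bar>a\<bar> - \<bar>b\<bar>)\<^sup>2" by simp
  then have "2 * \<bar>a * b\<bar> \<le> a\<^sup>2 + b\<^sup>2" by (simp add: power2_diff abs_mult)
  then show ?thesis using abs_ge_zero[of "a * b"] by linarith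
qed

lemma integral_shift:
  fixes f :: "real \<Rightarrow> 'a :: euclidean_space"
  shows "(LBINT u. f (u + a)) = (LBINT u. f u)"
  using lborel_integral_real_affine[of 1 f a] by (simp add: add.commute)

lemma integral_reflect_shift:
  fixes f :: "real \<Rightarrow> 'a :: euclidean_space"
  shows "(LBINT u. f (a - u)) = (LBINT u. f u)"
  using lborel_integral_real_affine[of "-1" f a] by simp

lemma integrable_shift:
  fixes f :: "real \<Rightarrow> 'a :: euclidean_space"
  shows "integrable lborel f \<Longrightarrow> integrable lborel (\<lambda>u. f (u + a))"
  using lborel_integrable_real_affine[of f 1 a] by (simp add: add.commute)

text \<open>
  This justifies every use of Fubini below with test functions. The inequality
  \<open>\<bar>ab\<bar> \<le> a\<^sup>2 + b\<^sup>2\<close> separates the two factors, and for each single factor the inner integral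
  \<open>\<integral> \<phi>(u + a(p))\<^sup>2 du\<close> does not depend on \<open>p\<close> by translation invariance. The weight \<open>k\<close> is
  a covariance function on \<open>\<real>\<close> in one application and \<open>K(x) K(y)\<close> on \<open>\<real>\<^sup>2\<close> in the other.
\<close>
lemma integrable_shifted_L2_product:
  assumes k: "integrable N k" and N: "sigma_finite_measure N"
    and [measurable]: "a \<in> borel_measurable N" "b \<in> borel_measurable N"
    and \<phi>: "\<phi> \<in> L2_real" and \<psi>: "\<psi> \<in> L2_real"
  shows "integrable (N \<Otimes>\<^sub>M lborel) (\<lambda>(p, u). k p * (\<phi> (u + a p) * \<psi> (u + b p)))"
proof -
  interpret N: sigma_finite_measure N by fact
  interpret P: pair_sigma_finite N lborel ..
  have [measurable]: "k \<in> borel_measurable N" using k by auto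
  have square: "integrable (N \<Otimes>\<^sub>M lborel) (\<lambda>(p, u). \<bar>k p\<bar> * (f (u + c p))\<^sup>2)"
    if f: "f \<in> L2_real" and [measurable]: "c \<in> borel_measurable N" for f c
  proof (rule P.Fubini_integrable)
    note [measurable] = L2_real_measurable[OF f]
    show "(\<lambda>(p, u). \<bar>k p\<bar> * (f (u + c p))\<^sup>2) \<in> borel_measurable (N \<Otimes>\<^sub>M lborel)"
      by measurable
    have f2: "integrable lborel (\<lambda>u. (f u)\<^sup>2)" using f by (simp add: L2_real_def)
    show "AE p in N. integrable lborel (\<lambda>u. case (p, u) of (p, u) \<Rightarrow> \<bar>k p\<bar> * (f (u + c p))\<^sup>2)"
      using integrable_shift[OF f2] by auto
    have norms: "(LBINT u. norm (case (p, u) of (p, u) \<Rightarrow> \<bar>k p\<bar> * (f (u + c p))\<^sup>2)) =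
        \<bar>k p\<bar> * (LBINT u. (f u)\<^sup>2)" for p
      using integral_shift[of "\<lambda>u. (f u)\<^sup>2" "c p"] by (simp add: abs_mult)
    show "integrable N (\<lambda>p. LBINT u. norm (case (p, u) of (p, u) \<Rightarrow> \<bar>k p\<bar> * (f (u + c p))\<^sup>2))"
      unfolding norms using k by simp
  qed
  note [measurable] = L2_real_measurable[OF \<phi>] L2_real_measurable[OF \<psi>]
  have "integrable (N \<Otimes>\<^sub>M lborel)
      (\<lambda>z. (\<lambda>(p, u). \<bar>k p\<bar> * (\<phi> (u + a p))\<^sup>2) z + (\<lambda>(p, u). \<bar>k p\<bar> * (\<psi> (u + b p))\<^sup>2) z)"
    by (intro Bochner_Integration.integrable_add square \<phi> \<psi>) measurable
  then show ?thesis
  proof (rule Bochner_Integration.integrable_bound)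
    show "AE z in N \<Otimes>\<^sub>M lborel. norm ((\<lambda>(p, u). k p * (\<phi> (u + a p) * \<psi> (u + b p))) z) \<le>
      norm ((\<lambda>(p, u). \<bar>k p\<bar> * (\<phi> (u + a p))\<^sup>2) z + (\<lambda>(p, u). \<bar>k p\<bar> * (\<psi> (u + b p))\<^sup>2) z)"
    proof (intro AE_I2, clarify)
      fix p u
      have "\<bar>\<phi> (u + a p) * \<psi> (u + b p)\<bar> \<le> (\<phi> (u + a p))\<^sup>2 + (\<psi> (u + b p))\<^sup>2"
        by (rule abs_mult_le_sum_squares)
      from mult_left_mono[OF this, of "\<bar>k p\<bar>"]
      show "norm (k p * (\<phi> (u + a p) * \<psi> (u + b p))) \<le>
          norm (\<bar>k p\<bar> * (\<phi> (u + a p))\<^sup>2 + \<bar>k p\<bar> * (\<psi> (u + b p))\<^sup>2)"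
        by (simp add: abs_mult distrib_left)
    qed
  qed measurable
qed

definition cross_correlation :: "(real \<Rightarrow> real) \<Rightarrow> (real \<Rightarrow> real) \<Rightarrow> real \<Rightarrow> real" where
  "cross_correlation f g h = (LBINT s. f (s + h) * g s)"

lemma integrable_L2_shift_mult:
  assumes \<phi>: "\<phi> \<in> L2_real" and \<psi>: "\<psi> \<in> L2_real"
  shows "integrable lborel (\<lambda>s. \<phi> (s + h) * \<psi> s)"
proof -
  note [measurable] = L2_real_measurable[OF \<phi>] L2_real_measurable[OF \<psi>]
  have "integrable lborel (\<lambda>s. (\<phi> (s + h))\<^sup>2 + (\<psi> s)\<^sup>2)"
    using \<phi> \<psi> by (intro Bochner_Integration.integrable_add integrable_shift[of "\<lambda>s. (\<phi> s)\<^sup>2"])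
       (auto simp: L2_real_def)
  then show ?thesis
  proof (rule Bochner_Integration.integrable_bound)
    show "AE s in lborel. norm (\<phi> (s + h) * \<psi> s) \<le> norm ((\<phi> (s + h))\<^sup>2 + (\<psi> s)\<^sup>2)"
    proof (rule AE_I2)
      fix s
      show "norm (\<phi> (s + h) * \<psi> s) \<le> norm ((\<phi> (s + h))\<^sup>2 + (\<psi> s)\<^sup>2)"
        using order_trans[OF abs_mult_le_sum_squares abs_ge_self] by simp
    qed
  qed measurable
qed

lemma cross_correlation_bounded:
  assumes \<phi>: "\<phi> \<in> L2_real" and \<psi>: "\<psi> \<in> L2_real"
  shows "\<bar>cross_correlation \<phi> \<psi> h\<bar> \<le> (LBINT s. (\<phi> s)\<^sup>2) + (LBINT s. (\<psi> s)\<^sup>2)"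
proof -
  have i\<phi>: "integrable lborel (\<lambda>s. (\<phi> s)\<^sup>2)" and i\<psi>: "integrable lborel (\<lambda>s. (\<psi> s)\<^sup>2)"
    using \<phi> \<psi> by (auto simp: L2_real_def)
  have "\<bar>cross_correlation \<phi> \<psi> h\<bar> \<le> (LBINT s. \<bar>\<phi> (s + h) * \<psi> s\<bar>)"
    unfolding cross_correlation_def by (rule integral_abs_bound)
  also have "\<dots> \<le> (LBINT s. (\<phi> (s + h))\<^sup>2 + (\<psi> s)\<^sup>2)"
  proof (rule integral_mono)
    fix s
    show "\<bar>\<phi> (s + h) * \<psi> s\<bar> \<le> (\<phi> (s + h))\<^sup>2 + (\<psi> s)\<^sup>2"
      by (rule abs_mult_le_sum_squares)
  qed (use integrable_L2_shift_mult[OF \<phi> \<psi>] integrable_shift[OF i\<phi>] i\<psi> in auto)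
  also have "\<dots> = (LBINT s. (\<phi> s)\<^sup>2) + (LBINT s. (\<psi> s)\<^sup>2)"
    using integrable_shift[OF i\<phi>] i\<psi> integral_shift[of "\<lambda>s. (\<phi> s)\<^sup>2" h] by simp
  finally show ?thesis .
qed

lemma cross_correlation_measurable:
  assumes [measurable]: "f \<in> borel_measurable borel" "g \<in> borel_measurable borel"
  shows "cross_correlation f g \<in> borel_measurable borel"
  unfolding cross_correlation_def by measurable

lemma integrable_cross_correlation_mult:
  assumes C: "integrable lborel C" and \<phi>: "\<phi> \<in> L2_real" and \<psi>: "\<psi> \<in> L2_real"
  shows "integrable lborel (\<lambda>h. C h * cross_correlation \<phi> \<psi> h)"
proof (rule Bochner_Integration.integrable_bound)
  note [measurable] = L2_real_measurable[OF \<phi>] L2_real_measurable[OF \<psi>]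
    cross_correlation_measurable[OF L2_real_measurable[OF \<phi>] L2_real_measurable[OF \<psi>]]
  have [measurable]: "C \<in> borel_measurable borel" using C by auto
  let ?B = "(LBINT s. (\<phi> s)\<^sup>2) + (LBINT s. (\<psi> s)\<^sup>2)"
  show "integrable lborel (\<lambda>h. C h * ?B)" using C by simp
  show "(\<lambda>h. C h * cross_correlation \<phi> \<psi> h) \<in> borel_measurable lborel" by measurable
  show "AE h in lborel. norm (C h * cross_correlation \<phi> \<psi> h) \<le> norm (C h * ?B)"
    using mult_left_mono[OF cross_correlation_bounded[OF \<phi> \<psi>] abs_ge_zero]
    by (intro AE_I2) (simp add: abs_mult)
qed

text \<open>
  The substitution \<open>t = s + h\<close> turns the defining double integral of a covariance function into a
  single integral that is linear in \<open>C\<close>; existence and uniqueness are both read off from this form.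
\<close>
lemma covariance_form_eq_cross_correlation:
  assumes C: "integrable lborel C" and \<phi>: "\<phi> \<in> L2_real" and \<psi>: "\<psi> \<in> L2_real"
  shows "(LBINT s. LBINT t. C (t - s) * \<phi> t * \<psi> s) = (LBINT h. C h * cross_correlation \<phi> \<psi> h)"
proof -
  have shift: "(LBINT t. C (t - s) * \<phi> t * \<psi> s) = (LBINT h. C h * (\<phi> (s + h) * \<psi> s))" for s
    using integral_shift[of "\<lambda>t. C (t - s) * \<phi> t * \<psi> s" s] by (simp add: ac_simps)
  have "integrable (lborel \<Otimes>\<^sub>M lborel) (\<lambda>(h, s). C h * (\<phi> (s + h) * \<psi> (s + 0)))"
    by (rule integrable_shifted_L2_product[OF C sigma_finite_lborel _ _ \<phi> \<psi>, where b = "\<lambda>_. 0"]) auto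
  then have "(LBINT s. LBINT h. C h * (\<phi> (s + h) * \<psi> s)) = (LBINT h. LBINT s. C h * (\<phi> (s + h) * \<psi> s))"
    using lborel_pair.Fubini_integral[of "\<lambda>h s. C h * (\<phi> (s + h) * \<psi> s)"] by simp
  then show ?thesis by (simp add: shift cross_correlation_def del: integral_mult_left_zero)
qed

definition autocorrelation :: "(real \<Rightarrow> real) \<Rightarrow> real \<Rightarrow> real" where
  "autocorrelation K h = (LBINT y. K y * K (y - h))"

text \<open>
  The pair \<open>(y, h) \<mapsto> (y, y - h)\<close> preserves the measure, so this is the integrability of a product
  of functions of separate variables.
\<close>
lemma integrable_pair_reflect:
  fixes K :: "real \<Rightarrow> real"
  assumes K: "integrable lborel K"
  shows "integrable (lborel \<Otimes>\<^sub>M lborel) (\<lambda>(y, h). K y * K (y - h))"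
proof -
  have [measurable]: "K \<in> borel_measurable borel" using K by auto
  show ?thesis
  proof (rule lborel_pair.Fubini_integrable)
    show "AE y in lborel. integrable lborel (\<lambda>h. case (y, h) of (y, h) \<Rightarrow> K y * K (y - h))"
      using lborel_integrable_real_affine[OF K, of "-1"] by auto
    have norms: "(LBINT h. norm (case (y, h) of (y, h) \<Rightarrow> K y * K (y - h))) = \<bar>K y\<bar> * (LBINT x. \<bar>K x\<bar>)" for y
      using integral_reflect_shift[of "\<lambda>x. \<bar>K x\<bar>" y] by (simp add: abs_mult)
    show "integrable lborel (\<lambda>y. LBINT h. norm (case (y, h) of (y, h) \<Rightarrow> K y * K (y - h)))"
      unfolding norms using K by simp
  qed measurable
qed

lemma integrable_autocorrelation:
  assumes K: "integrable lborel K"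
  shows "integrable lborel (autocorrelation K)"
proof -
  show ?thesis
    using lborel_pair.integrable_snd[OF integrable_pair_reflect[OF K]] unfolding autocorrelation_def[abs_def] by simp
qed

text \<open>
  Write the product of convolutions as \<open>\<integral>\<integral> K(x) K(y) \<phi>(u - x) \<psi>(u - y) dx dy\<close> and integrate over
  \<open>u\<close> first: \<open>u = s + y\<close> shows that the inner integral is the cross correlation at \<open>y - x\<close>.
  Collecting the pairs with \<open>y - x = h\<close> leaves the autocorrelation of \<open>K\<close> as weight.
\<close>
lemma convol_mult_convol:
  assumes K: "integrable lborel K" and \<phi>: "\<phi> \<in> L2_real" and \<psi>: "\<psi> \<in> L2_real"
  shows integrable_convol_mult_convol: "integrable lborel (\<lambda>u. convol K \<phi> u * convol K \<psi> u)"
    and integral_convol_mult_convol: "(LBINT u. convol K \<phi> u * convol K \<psi> u) =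
      (LBINT h. autocorrelation K h * cross_correlation \<phi> \<psi> h)"
proof -
  let ?N = "lborel \<Otimes>\<^sub>M lborel :: (real \<times> real) measure"
  have N: "sigma_finite_measure ?N" unfolding lborel_prod by (rule sigma_finite_lborel)
  interpret N: sigma_finite_measure ?N by (rule N)
  interpret Q: pair_sigma_finite ?N lborel ..
  note [measurable] = L2_real_measurable[OF \<phi>] L2_real_measurable[OF \<psi>]
    cross_correlation_measurable[OF L2_real_measurable[OF \<phi>] L2_real_measurable[OF \<psi>]]
  have [measurable]: "K \<in> borel_measurable borel" using K by auto
  define F where "F = (\<lambda>p u. (case p of (x, y) \<Rightarrow> K x * K y) * (\<phi> (u + - fst p) * \<psi> (u + - snd p)))"
  have KK: "integrable ?N (\<lambda>(x, y). K x * K y)"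
    by (rule lborel_pair.Fubini_integrable) (use K in \<open>auto simp: abs_mult\<close>)
  have F: "integrable (?N \<Otimes>\<^sub>M lborel) (case_prod F)"
    unfolding F_def by (rule integrable_shifted_L2_product[OF KK N _ _ \<phi> \<psi>]) measurable
  (* For almost every u the integrand is integrable in the pair (x, y), and only there does the
     integral over the plane factor into the two convolutions. *)
  have sections: "AE u in lborel. integrable ?N (\<lambda>p. F p u)"
    using Q.AE_integrable_snd[OF F] by simp
  have product: "AE u in lborel. (LINT p|?N. F p u) = convol K \<phi> u * convol K \<psi> u"
    using sections
  proof eventually_elim
    case (elim u)
    have "(LINT p|?N. F p u) = (LBINT x. LBINT y. F (x, y) u)"
      using lborel_pair.integral_fst'[OF elim] by simp
    also have "\<dots> = (LBINT x. LBINT y. (K x * \<phi> (u - x)) * (K y * \<psi> (u - y)))"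
      by (simp add: F_def ac_simps)
    also have "\<dots> = convol K \<phi> u * convol K \<psi> u"
      by (simp only: integral_mult_right_zero integral_mult_left_zero convol_def)
    finally show ?case .
  qed
  have [measurable]: "convol K \<phi> \<in> borel_measurable borel" "convol K \<psi> \<in> borel_measurable borel"
    unfolding convol_def[abs_def] by measurable
  have Fu: "integrable lborel (\<lambda>u. LINT p|?N. F p u)"
    using Q.integrable_snd[OF F] .
  show "integrable lborel (\<lambda>u. convol K \<phi> u * convol K \<psi> u)"
    using integrable_cong_AE[OF _ _ product] Fu by (simp add: borel_measurable_integrable[OF Fu, simplified])
  let ?R = "cross_correlation \<phi> \<psi>"
  have inner: "(LBINT u. F (x, y) u) = K x * K y * ?R (y - x)" for x y
    using integral_shift[of "\<lambda>u. \<phi> (u - x) * \<psi> (u - y)" y]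
    by (simp add: F_def cross_correlation_def algebra_simps)
  have KKR: "integrable ?N (\<lambda>(x, y). K x * K y * ?R (y - x))"
    using Q.integrable_fst[OF F] by (rule back_subst[of "integrable ?N"]) (auto simp: inner)
  have yh: "integrable (lborel \<Otimes>\<^sub>M lborel) (\<lambda>(y, h). K y * K (y - h) * ?R h)"
  proof (rule Bochner_Integration.integrable_bound)
    let ?B = "(LBINT s. (\<phi> s)\<^sup>2) + (LBINT s. (\<psi> s)\<^sup>2)"
    show "integrable (lborel \<Otimes>\<^sub>M lborel) (\<lambda>z. (case z of (y, h) \<Rightarrow> K y * K (y - h)) * ?B)"
      using integrable_pair_reflect[OF K] by simp
    show "AE z in lborel \<Otimes>\<^sub>M lborel. norm (case z of (y, h) \<Rightarrow> K y * K (y - h) * ?R h) \<le>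
        norm ((case z of (y, h) \<Rightarrow> K y * K (y - h)) * ?B)"
      by (intro AE_I2) (auto simp: abs_mult intro!: mult_left_mono cross_correlation_bounded[OF \<phi> \<psi>])
  qed measurable
  have "(LBINT u. convol K \<phi> u * convol K \<psi> u) = (LBINT u. LINT p|?N. F p u)"
    using product Fu by (intro integral_cong_AE) (auto simp: borel_measurable_integrable[OF Fu, simplified])
  also have "\<dots> = (LINT p|?N. (LBINT u. F p u))" by (rule Q.Fubini_integral[OF F])
  also have "\<dots> = (LINT p|?N. (case p of (x, y) \<Rightarrow> K x * K y * ?R (y - x)))"
    by (intro Bochner_Integration.integral_cong) (auto simp: inner)
  also have "\<dots> = (LBINT y. LBINT x. K x * K y * ?R (y - x))"
    using lborel_pair.integral_snd[OF KKR] by simp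
  also have "\<dots> = (LBINT y. LBINT h. K y * K (y - h) * ?R h)"
  proof (rule Bochner_Integration.integral_cong[OF refl])
    fix y
    show "(LBINT x. K x * K y * ?R (y - x)) = (LBINT h. K y * K (y - h) * ?R h)"
      using integral_reflect_shift[of "\<lambda>x. K x * K y * ?R (y - x)" y] by (simp add: ac_simps)
  qed
  also have "\<dots> = (LBINT h. LBINT y. K y * K (y - h) * ?R h)"
    using lborel_pair.Fubini_integral[OF yh] by simp
  also have "\<dots> = (LBINT h. autocorrelation K h * ?R h)"
    by (simp add: autocorrelation_def)
  finally show "(LBINT u. convol K \<phi> u * convol K \<psi> u) = (LBINT h. autocorrelation K h * ?R h)" .
qed

text \<open>
  The case \<open>\<phi> = \<psi>\<close> of the integrability above: the white noise may be applied to \<open>convol K \<phi>\<close>.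
\<close>
lemma convol_L2:
  assumes K: "integrable lborel K" and \<phi>: "\<phi> \<in> L2_real"
  shows "convol K \<phi> \<in> L2_real"
proof -
  note [measurable] = L2_real_measurable[OF \<phi>]
  have [measurable]: "K \<in> borel_measurable borel" using K by auto
  have "convol K \<phi> \<in> borel_measurable borel"
    unfolding convol_def[abs_def] by measurable
  then show ?thesis
    using integrable_convol_mult_convol[OF K \<phi> \<phi>] by (simp add: L2_real_def power2_eq_square)
qed


section \<open>Fourier transforms of correlations\<close>

text \<open>
  The autocorrelation is the convolution of \<open>K\<close> with its reflection, whose Fourier transform is the
  complex conjugate of that of \<open>K\<close> because \<open>K\<close> is real: with \<open>x = y - h\<close> the exponential splits as
  \<open>exp(i\<tau>h) = exp(i\<tau>y) cnj(exp(i\<tau>x))\<close>.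
\<close>
lemma fourier_autocorrelation:
  assumes K: "integrable lborel K"
  shows "(LBINT h. exp (\<i> * of_real (\<tau> * h)) * complex_of_real (autocorrelation K h)) =
    of_real ((cmod (LBINT x. exp (\<i> * of_real (\<tau> * x)) * complex_of_real (K x)))\<^sup>2)"
proof -
  have [measurable]: "K \<in> borel_measurable borel" using K by auto
  let ?e = "\<lambda>x. exp (\<i> * of_real (\<tau> * x)) :: complex"
  let ?k = "LBINT x. ?e x * complex_of_real (K x)"
  have int: "integrable (lborel \<Otimes>\<^sub>M lborel) (\<lambda>(y, h). ?e h * complex_of_real (K y * K (y - h)))"
    by (rule Bochner_Integration.integrable_bound[OF integrable_pair_reflect[OF K]])
       (auto simp: norm_mult norm_exp_eq_Re)
  have "(LBINT h. ?e h * complex_of_real (autocorrelation K h)) =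
      (LBINT h. LBINT y. ?e h * complex_of_real (K y * K (y - h)))"
    by (simp add: autocorrelation_def flip: integral_complex_of_real)
  also have "\<dots> = (LBINT y. LBINT h. ?e h * complex_of_real (K y * K (y - h)))"
    using lborel_pair.Fubini_integral[OF int] .
  also have "\<dots> = (LBINT y. LBINT x. (?e y * complex_of_real (K y)) * cnj (?e x * complex_of_real (K x)))"
  proof (rule Bochner_Integration.integral_cong[OF refl])
    fix y
    have "(LBINT h. ?e h * complex_of_real (K y * K (y - h))) =
        (LBINT x. ?e (y - x) * complex_of_real (K y * K x))"
      using integral_reflect_shift[of "\<lambda>h. ?e h * complex_of_real (K y * K (y - h))" y] by simp
    also have "\<dots> = (LBINT x. (?e y * complex_of_real (K y)) * cnj (?e x * complex_of_real (K x)))"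
    proof (rule Bochner_Integration.integral_cong[OF refl])
      fix x
      have "?e (y - x) = ?e y * cnj (?e x)"
        by (simp add: exp_cnj right_diff_distrib flip: exp_add)
      then show "?e (y - x) * complex_of_real (K y * K x) =
          (?e y * complex_of_real (K y)) * cnj (?e x * complex_of_real (K x))"
        by (simp add: ac_simps)
    qed
    finally show "(LBINT h. ?e h * complex_of_real (K y * K (y - h))) =
        (LBINT x. (?e y * complex_of_real (K y)) * cnj (?e x * complex_of_real (K x)))" .
  qed
  also have "\<dots> = ?k * cnj ?k"
    by (simp only: integral_mult_right_zero integral_mult_left_zero Bochner_Integration.integral_cnj)
  also have "\<dots> = of_real ((cmod ?k)\<^sup>2)"
    by (simp only: complex_norm_square)
  finally show ?thesis .
qed

definition truncation :: "nat \<Rightarrow> (real \<Rightarrow> real) \<Rightarrow> real \<Rightarrow> real" where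
  "truncation n f s = indicator {0..real n} s * f s"

lemma truncation_L2:
  assumes [measurable]: "f \<in> borel_measurable borel" and "\<And>s. \<bar>f s\<bar> \<le> 1"
  shows "truncation n f \<in> L2_real"
proof -
  have "integrable lborel (\<lambda>s. (truncation n f s)\<^sup>2)"
  proof (rule Bochner_Integration.integrable_bound)
    show "integrable lborel (indicat_real {0..real n})" by simp
    show "(\<lambda>s. (truncation n f s)\<^sup>2) \<in> borel_measurable lborel" unfolding truncation_def by measurable
    show "AE s in lborel. norm ((truncation n f s)\<^sup>2) \<le> norm (indicat_real {0..real n} s)"
      using assms(2) by (auto simp: truncation_def power_mult_distrib indicator_def abs_square_le_1)
  qed
  moreover have "truncation n f \<in> borel_measurable borel" unfolding truncation_def[abs_def] by measurable
  ultimately show ?thesis by (simp add: L2_real_def)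
qed

text \<open>
  The triangular (Fejer) window. Divided by \<open>n\<close> it is bounded by 1 and tends to 1 pointwise, which
  lets a limit in \<open>n\<close> remove it.
\<close>
lemma cross_correlation_truncation_1:
  "cross_correlation (truncation n (\<lambda>_. 1)) (truncation n (\<lambda>_. 1)) h = max 0 (real n - \<bar>h\<bar>)"
proof -
  have "truncation n (\<lambda>_. 1) (s + h) * truncation n (\<lambda>_. 1) s = indicator {max 0 (- h)..min (real n) (real n - h)} s" for s
    by (auto simp: truncation_def indicator_def)
  then have "cross_correlation (truncation n (\<lambda>_. 1)) (truncation n (\<lambda>_. 1)) h =
      measure lborel {max 0 (- h)..min (real n) (real n - h)}"
    by (simp add: cross_correlation_def)
  also have "\<dots> = max 0 (real n - \<bar>h\<bar>)"
    by (cases "max 0 (- h) \<le> min (real n) (real n - h)") auto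
  finally show ?thesis .
qed

text \<open>
  Test with \<open>cos(\<tau>s)\<close> and \<open>sin(\<tau>s)\<close> truncated to \<open>[0, n]\<close>. By the addition theorems, sums and
  differences of their cross correlations are \<open>cos(\<tau>h)\<close> and \<open>sin(\<tau>h)\<close> times the triangular window,
  since only the phase difference \<open>\<tau>(s + h) - \<tau>s = \<tau>h\<close> enters. Dominated convergence removes the window.
\<close>
lemma fourier_eq_0_if_orthogonal_to_cross_correlations:
  assumes D: "integrable lborel D"
    and orth: "\<And>\<phi> \<psi>. \<phi> \<in> L2_real \<Longrightarrow> \<psi> \<in> L2_real \<Longrightarrow> (LBINT h. D h * cross_correlation \<phi> \<psi> h) = 0"
  shows "(LBINT h. exp (\<i> * of_real (\<tau> * h)) * complex_of_real (D h)) = 0"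
proof -
  have [measurable]: "D \<in> borel_measurable borel" using D by auto
  define c where "c = (\<lambda>n. truncation n (\<lambda>s. cos (\<tau> * s)))"
  define d where "d = (\<lambda>n. truncation n (\<lambda>s. sin (\<tau> * s)))"
  define w where "w = (\<lambda>n h. max 0 (real n - \<bar>h\<bar>))"
  have c: "c n \<in> L2_real" and d: "d n \<in> L2_real" for n
    unfolding c_def d_def by (rule truncation_L2; simp)+
  note int = integrable_L2_shift_mult
  have cos_eq: "w n h * cos (\<tau> * h) = cross_correlation (c n) (c n) h + cross_correlation (d n) (d n) h" for n h
  proof -
    have "cross_correlation (c n) (c n) h + cross_correlation (d n) (d n) h =
        (LBINT s. c n (s + h) * c n s + d n (s + h) * d n s)"
      unfolding cross_correlation_def
      by (rule Bochner_Integration.integral_add[symmetric]) (intro int c d)+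
    also have "\<dots> = (LBINT s. (truncation n (\<lambda>_. 1) (s + h) * truncation n (\<lambda>_. 1) s) * cos (\<tau> * h))"
    proof (rule Bochner_Integration.integral_cong[OF refl])
      fix s
      have "\<tau> * h = \<tau> * (s + h) - \<tau> * s" by (simp add: algebra_simps)
      then have "cos (\<tau> * h) = cos (\<tau> * (s + h) - \<tau> * s)" by (rule arg_cong)
      then show "c n (s + h) * c n s + d n (s + h) * d n s =
          (truncation n (\<lambda>_. 1) (s + h) * truncation n (\<lambda>_. 1) s) * cos (\<tau> * h)"
        unfolding cos_diff c_def d_def truncation_def by (simp only:) (simp add: distrib_left mult_ac)
    qed
    also have "\<dots> = w n h * cos (\<tau> * h)"
      unfolding integral_mult_left_zero w_def cross_correlation_truncation_1[symmetric] cross_correlation_def ..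
    finally show ?thesis ..
  qed
  have sin_eq: "w n h * sin (\<tau> * h) = cross_correlation (d n) (c n) h - cross_correlation (c n) (d n) h" for n h
  proof -
    have "cross_correlation (d n) (c n) h - cross_correlation (c n) (d n) h =
        (LBINT s. d n (s + h) * c n s - c n (s + h) * d n s)"
      unfolding cross_correlation_def
      by (rule Bochner_Integration.integral_diff[symmetric]) (intro int c d)+
    also have "\<dots> = (LBINT s. (truncation n (\<lambda>_. 1) (s + h) * truncation n (\<lambda>_. 1) s) * sin (\<tau> * h))"
    proof (rule Bochner_Integration.integral_cong[OF refl])
      fix s
      have "\<tau> * h = \<tau> * (s + h) - \<tau> * s" by (simp add: algebra_simps)
      then have "sin (\<tau> * h) = sin (\<tau> * (s + h) - \<tau> * s)" by (rule arg_cong)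
      then show "d n (s + h) * c n s - c n (s + h) * d n s =
          (truncation n (\<lambda>_. 1) (s + h) * truncation n (\<lambda>_. 1) s) * sin (\<tau> * h)"
        unfolding sin_diff c_def d_def truncation_def by (simp only:) (simp add: right_diff_distrib mult_ac)
    qed
    also have "\<dots> = w n h * sin (\<tau> * h)"
      unfolding integral_mult_left_zero w_def cross_correlation_truncation_1[symmetric] cross_correlation_def ..
    finally show ?thesis ..
  qed
  note intR = integrable_cross_correlation_mult[OF D]
  have cos0: "(LBINT h. D h * (w n h * cos (\<tau> * h))) = 0" for n
    unfolding cos_eq distrib_left
    by (subst Bochner_Integration.integral_add) (simp_all add: intR orth c d)
  have sin0: "(LBINT h. D h * (w n h * sin (\<tau> * h))) = 0" for n
    unfolding sin_eq right_diff_distrib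
    by (subst Bochner_Integration.integral_diff) (simp_all add: intR orth c d)
  have limit: "(LBINT h. D h * g h) = 0"
    if [measurable]: "g \<in> borel_measurable borel" and g: "\<And>h. \<bar>g h\<bar> \<le> 1" and 0: "\<And>n. (LBINT h. D h * (w n h * g h)) = 0" for g
  proof -
    (* The index is shifted to Suc n so that the normalising division is by a positive number. *)
    have "(\<lambda>n. LBINT h. D h * (w (Suc n) h / real (Suc n) * g h)) \<longlonglongrightarrow> (LBINT h. D h * g h)"
    proof (rule integral_dominated_convergence)
      show "integrable lborel (\<lambda>h. \<bar>D h\<bar>)" using D by simp
      show "AE h in lborel. (\<lambda>n. D h * (w (Suc n) h / real (Suc n) * g h)) \<longlonglongrightarrow> D h * g h"
      proof (rule AE_I2)
        fix h
        have "(\<lambda>n. max 0 (1 - \<bar>h\<bar> * inverse (real (Suc n)))) \<longlonglongrightarrow> max 0 (1 - \<bar>h\<bar> * 0)"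
          by (intro tendsto_intros LIMSEQ_inverse_real_of_nat)
        moreover have "max 0 (1 - \<bar>h\<bar> * inverse (real (Suc n))) = w (Suc n) h / real (Suc n)" for n
        proof -
          have "1 - \<bar>h\<bar> * inverse (real (Suc n)) = (real (Suc n) - \<bar>h\<bar>) / real (Suc n)"
            by (simp add: field_simps)
          then show ?thesis unfolding w_def by (simp add: max_def divide_le_0_iff zero_le_divide_iff)
        qed
        ultimately have "(\<lambda>n. w (Suc n) h / real (Suc n)) \<longlonglongrightarrow> 1" by simp
        then have "(\<lambda>n. D h * (w (Suc n) h / real (Suc n) * g h)) \<longlonglongrightarrow> D h * (1 * g h)"
          by (intro tendsto_intros)
        then show "(\<lambda>n. D h * (w (Suc n) h / real (Suc n) * g h)) \<longlonglongrightarrow> D h * g h" by simp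
      qed
      show "AE h in lborel. norm (D h * (w (Suc n) h / real (Suc n) * g h)) \<le> \<bar>D h\<bar>" for n
      proof (rule AE_I2)
        fix h
        have "\<bar>w (Suc n) h / real (Suc n)\<bar> \<le> 1" by (simp add: w_def)
        then have "\<bar>w (Suc n) h / real (Suc n)\<bar> * \<bar>g h\<bar> \<le> 1" using g by (intro mult_le_one) auto
        then show "norm (D h * (w (Suc n) h / real (Suc n) * g h)) \<le> \<bar>D h\<bar>"
          unfolding real_norm_def abs_mult by (rule mult_left_le) simp
      qed
    qed (unfold w_def, measurable)
    moreover have "(LBINT h. D h * (w (Suc n) h / real (Suc n) * g h)) = 0" for n
    proof -
      have "(LBINT h. D h * (w (Suc n) h / real (Suc n) * g h)) = (LBINT h. D h * (w (Suc n) h * g h) / real (Suc n))"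
        by simp
      also have "\<dots> = 0" unfolding integral_divide_zero 0 by simp
      finally show ?thesis .
    qed
    ultimately show ?thesis using LIMSEQ_unique[OF _ tendsto_const] by simp
  qed
  have "(LBINT h. exp (\<i> * of_real (\<tau> * h)) * complex_of_real (D h)) =
      (LBINT h. complex_of_real (D h * cos (\<tau> * h)) + \<i> * complex_of_real (D h * sin (\<tau> * h)))"
    by (intro Bochner_Integration.integral_cong refl) (simp add: exp_Euler cos_of_real sin_of_real algebra_simps flip: of_real_mult)
  also have "\<dots> = complex_of_real (LBINT h. D h * cos (\<tau> * h)) + \<i> * complex_of_real (LBINT h. D h * sin (\<tau> * h))"
  proof -
    have "integrable lborel (\<lambda>h. D h * cos (\<tau> * h))" "integrable lborel (\<lambda>h. D h * sin (\<tau> * h))"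
      by (rule Bochner_Integration.integrable_bound[OF D]; simp add: abs_mult mult_left_le)+
    then show ?thesis by (simp only: Bochner_Integration.integral_add integrable_of_real integrable_mult_right
       integral_mult_right_zero integral_complex_of_real)
  qed
  also have "\<dots> = 0"
    using limit[of "\<lambda>h. cos (\<tau> * h)"] limit[of "\<lambda>h. sin (\<tau> * h)"] cos0 sin0 by simp
  finally show ?thesis .
qed

section \<open>Covariance functions of moving averages of white noise\<close>

lemma gaussian_rv_square_integrable:
  assumes "prob_space M" "gaussian_rv M Y"
  shows "Y \<in> borel_measurable M" "integrable M (\<lambda>\<omega>. (Y \<omega>)\<^sup>2)"
proof -
  interpret prob_space M by fact
  show [measurable]: "Y \<in> borel_measurable M" using assms(2) by (simp add: gaussian_rv_def)
  consider m where "AE \<omega> in M. Y \<omega> = m"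
    | m v where "v > 0" "distributed M lborel Y (normal_density m v)"
    using assms(2) by (auto simp: gaussian_rv_def)
  then show "integrable M (\<lambda>\<omega>. (Y \<omega>)\<^sup>2)"
  proof cases
    case (1 m)
    have sq: "AE \<omega> in M. m\<^sup>2 = (Y \<omega>)\<^sup>2"
      by (rule AE_mp[OF 1]) (rule AE_I2, simp)
    have "integrable M (\<lambda>\<omega>. m\<^sup>2)" by simp
    then show ?thesis
      by (rule integrable_cong_AE_imp) (measurable, rule sq)
  next
    case (2 m v)
    have "integrable lborel (\<lambda>x. normal_density m v x * (x - m)^2 + 2 * m * (normal_density m v x * x) - m\<^sup>2 * normal_density m v x)"
      using 2(1) by (intro Bochner_Integration.integrable_add Bochner_Integration.integrable_diff integrable_mult_right integrable_normal_moment integrable_normal_moment_nz_1) auto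
    then have "integrable lborel (\<lambda>x. normal_density m v x * x\<^sup>2)"
      by (rule back_subst[of "integrable lborel"]) (auto simp: fun_eq_iff power2_eq_square algebra_simps)
    then show ?thesis
      using distributed_integrable[OF 2(2), of "\<lambda>x. x\<^sup>2"] by (simp add: normal_density_nonneg)
  qed
qed

lemma moving_average_second_moment:
  assumes W: "white_noise M \<sigma> W" and K: "integrable lborel K" and \<phi>: "\<phi> \<in> L2_real" and \<psi>: "\<psi> \<in> L2_real"
  shows "(LINT \<omega>|M. moving_average W K \<phi> \<omega> * moving_average W K \<psi> \<omega>) =
    (LBINT h. (\<sigma>\<^sup>2 * autocorrelation K h) * cross_correlation \<phi> \<psi> h)"
proof -
  have "(LINT \<omega>|M. moving_average W K \<phi> \<omega> * moving_average W K \<psi> \<omega>) =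
      \<sigma>\<^sup>2 * (LBINT u. convol K \<phi> u * convol K \<psi> u)"
    using W convol_L2[OF K \<phi>] convol_L2[OF K \<psi>]
    unfolding white_noise_def moving_average_def by blast
  then show ?thesis
    unfolding integral_convol_mult_convol[OF K \<phi> \<psi>] by (simp add: mult.assoc)
qed

text \<open>
  Square integrability of \<open>X(\<phi>)\<close> needs the Gaussian assumption: the prescribed second moments alone
  would allow a Bochner integral that is 0 by default.
\<close>
lemma is_covariance_function_moving_average:
  assumes W: "white_noise M \<sigma> W" and K: "integrable lborel K"
  shows "is_covariance_function M (moving_average W K) (\<lambda>h. \<sigma>\<^sup>2 * autocorrelation K h)"
proof -
  have C: "integrable lborel (\<lambda>h. \<sigma>\<^sup>2 * autocorrelation K h)"
    using integrable_autocorrelation[OF K] by simp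
  have "moving_average W K \<phi> \<in> borel_measurable M \<and> integrable M (\<lambda>\<omega>. (moving_average W K \<phi> \<omega>)\<^sup>2) \<and>
      (LINT \<omega>|M. moving_average W K \<phi> \<omega>) = 0" if \<phi>: "\<phi> \<in> L2_real" for \<phi>
  proof -
    have prob: "prob_space M" and fam: "gaussian_family M L2_real W"
      and mean: "(LINT \<omega>|M. W (convol K \<phi>) \<omega>) = 0"
      using W convol_L2[OF K \<phi>] unfolding white_noise_def by blast+
    have "gaussian_rv M (\<lambda>\<omega>. \<Sum>j\<in>{convol K \<phi>}. 1 * W j \<omega>)"
      using fam[unfolded gaussian_family_def, rule_format, of "{convol K \<phi>}" "\<lambda>_. 1"] convol_L2[OF K \<phi>] by simp
    then show ?thesis
      using gaussian_rv_square_integrable[OF prob, of "W (convol K \<phi>)"] mean by (simp add: moving_average_def)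
  qed
  moreover have "(LINT \<omega>|M. moving_average W K \<phi> \<omega> * moving_average W K \<psi> \<omega>) =
      (LBINT s. LBINT t. (\<sigma>\<^sup>2 * autocorrelation K (t - s)) * \<phi> t * \<psi> s)"
    if "\<phi> \<in> L2_real" "\<psi> \<in> L2_real" for \<phi> \<psi>
    unfolding moving_average_second_moment[OF W K that]
    by (rule covariance_form_eq_cross_correlation[OF C that, symmetric])
  ultimately show ?thesis unfolding is_covariance_function_def using C by blast
qed

text \<open>
  Two covariance functions have the same integral against every cross correlation, hence the same
  Fourier transform at every frequency. So the autocorrelation may stand for an arbitrary one.
\<close>
lemma spectral_density_moving_average:
  assumes W: "white_noise M \<sigma> W" and K: "integrable lborel K"
    and C: "is_covariance_function M (moving_average W K) C"
  shows "spectral_density_of C \<tau> =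
    of_real (\<sigma>\<^sup>2 * (cmod (LBINT x. exp (\<i> * of_real (\<tau> * x)) * complex_of_real (K x)))\<^sup>2)"
proof -
  let ?e = "\<lambda>h. exp (\<i> * of_real (\<tau> * h)) :: complex"
  let ?C = "\<lambda>h. \<sigma>\<^sup>2 * autocorrelation K h"
  have intC: "integrable lborel C" using C by (simp add: is_covariance_function_def)
  have intC': "integrable lborel ?C" using integrable_autocorrelation[OF K] by simp
  have fourier: "integrable lborel (\<lambda>h. ?e h * complex_of_real (f h))" if f: "integrable lborel f" for f
  proof -
    have [measurable]: "f \<in> borel_measurable borel" using f by auto
    show ?thesis by (rule Bochner_Integration.integrable_bound[OF f]) (auto simp: norm_mult)
  qed
  have "(LBINT h. (C h - ?C h) * cross_correlation \<phi> \<psi> h) = 0"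
    if \<phi>: "\<phi> \<in> L2_real" and \<psi>: "\<psi> \<in> L2_real" for \<phi> \<psi>
  proof -
    have "(LINT \<omega>|M. moving_average W K \<phi> \<omega> * moving_average W K \<psi> \<omega>) =
        (LBINT s. LBINT t. C (t - s) * \<phi> t * \<psi> s)"
      using C \<phi> \<psi> unfolding is_covariance_function_def by blast
    then have "(LBINT h. C h * cross_correlation \<phi> \<psi> h) = (LBINT h. ?C h * cross_correlation \<phi> \<psi> h)"
      unfolding moving_average_second_moment[OF W K \<phi> \<psi>]
        covariance_form_eq_cross_correlation[OF intC \<phi> \<psi>] by (rule sym)
    then show ?thesis
      using integrable_cross_correlation_mult[OF intC \<phi> \<psi>] integrable_cross_correlation_mult[OF intC' \<phi> \<psi>]
      by (simp add: left_diff_distrib)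
  qed
  then have "(LBINT h. ?e h * complex_of_real (C h - ?C h)) = 0"
    using intC intC' by (intro fourier_eq_0_if_orthogonal_to_cross_correlations) auto
  then have "(LBINT h. ?e h * complex_of_real (C h)) = (LBINT h. ?e h * complex_of_real (?C h))"
    using fourier[OF intC] fourier[OF intC'] unfolding of_real_diff right_diff_distrib by simp
  also have "\<dots> = (LBINT h. of_real (\<sigma>\<^sup>2) * (?e h * complex_of_real (autocorrelation K h)))"
    by (simp add: mult_ac)
  also have "\<dots> = of_real (\<sigma>\<^sup>2) * (LBINT h. ?e h * complex_of_real (autocorrelation K h))"
    by (rule integral_mult_right_zero)
  finally show ?thesis
    unfolding spectral_density_of_def fourier_autocorrelation[OF K] by simp
qed

section \<open>Laplace transforms in the right half-plane\<close>

definition laplace_transform :: "(real \<Rightarrow> real) \<Rightarrow> complex \<Rightarrow> complex" where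
  "laplace_transform f \<xi> = (LBINT z. exp (- (\<xi> * of_real z)) * of_real (f z))"

lemma norm_laplace_integrand_le:
  assumes "0 \<le> Re \<xi>" "\<And>z. z < 0 \<Longrightarrow> f z = 0"
  shows "cmod (exp (- (\<xi> * of_real z)) * of_real (f z)) \<le> \<bar>f z\<bar>"
proof (cases "z < 0")
  case False
  then have "0 \<le> Re \<xi> * z" using assms by simp
  then have "cmod (exp (- (\<xi> * of_real z))) \<le> 1" by (simp add: norm_exp_eq_Re)
  then show ?thesis
    using mult_right_mono[of "cmod (exp (- (\<xi> * of_real z)))" 1 "\<bar>f z\<bar>"] by (simp add: norm_mult)
qed (use assms in auto)

lemma integrable_laplace_integrand:
  assumes f: "integrable lborel f" and "\<And>z. z < 0 \<Longrightarrow> f z = 0" "0 \<le> Re \<xi>"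
  shows "integrable lborel (\<lambda>z. exp (- (\<xi> * of_real z)) * complex_of_real (f z))"
proof (rule Bochner_Integration.integrable_bound)
  have [measurable]: "f \<in> borel_measurable borel" using f by auto
  show "integrable lborel (\<lambda>z. \<bar>f z\<bar>)" using f by simp
  show "(\<lambda>z. exp (- (\<xi> * of_real z)) * complex_of_real (f z)) \<in> borel_measurable lborel" by measurable
  show "AE z in lborel. cmod (exp (- (\<xi> * of_real z)) * complex_of_real (f z)) \<le> norm \<bar>f z\<bar>"
    unfolding real_norm_def abs_abs by (intro AE_I2 norm_laplace_integrand_le assms)
qed

lemma laplace_transform_sequentially_continuous:
  assumes f: "integrable lborel f" and f0: "\<And>z. z < 0 \<Longrightarrow> f z = 0"
    and X: "X \<longlonglongrightarrow> \<xi>" and Re: "\<And>n. 0 \<le> Re (X n)"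
  shows "(\<lambda>n. laplace_transform f (X n)) \<longlonglongrightarrow> laplace_transform f \<xi>"
  unfolding laplace_transform_def
proof (rule integral_dominated_convergence)
  have [measurable]: "f \<in> borel_measurable borel" using f by auto
  show "integrable lborel (\<lambda>z. \<bar>f z\<bar>)" using f by simp
  show "AE z in lborel. (\<lambda>n. exp (- (X n * of_real z)) * complex_of_real (f z)) \<longlonglongrightarrow>
      exp (- (\<xi> * of_real z)) * complex_of_real (f z)"
    by (intro AE_I2 tendsto_intros X)
  show "AE z in lborel. cmod (exp (- (X n * of_real z)) * complex_of_real (f z)) \<le> \<bar>f z\<bar>" for n
    by (intro AE_I2 norm_laplace_integrand_le Re f0)
  show "(\<lambda>z. exp (- (\<xi> * of_real z)) * complex_of_real (f z)) \<in> borel_measurable lborel" by measurable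
  show "(\<lambda>z. exp (- (X n * of_real z)) * complex_of_real (f z)) \<in> borel_measurable lborel" for n by measurable
qed

text \<open>
  A bound on the difference quotients that is uniform in \<open>z\<close>: the derivative \<open>-z exp(-vz)\<close> is at most
  \<open>z exp(-dz) \<le> 1/d\<close> on the half-plane \<open>Re v \<ge> d\<close>, which is convex. It provides the integrable
  majorant for differentiation under the integral.
\<close>
lemma norm_exp_difference_le:
  assumes d: "0 < d" and w: "d \<le> Re w" "d \<le> Re \<xi>" and z: "0 \<le> z"
  shows "cmod (exp (- (w * of_real z)) - exp (- (\<xi> * of_real z))) \<le> 1 / d * cmod (w - \<xi>)"
proof (rule field_differentiable_bound)
  show "convex {v. d \<le> Re v}" by (rule convex_halfspace_Re_ge)
  show "((\<lambda>v. exp (- (v * of_real z))) has_field_derivative - of_real z * exp (- (v * of_real z)))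
      (at v within {v. d \<le> Re v})" for v
    by (auto intro!: derivative_eq_intros)
  fix v assume "v \<in> {v. d \<le> Re v}"
  then have "d * z \<le> Re v * z" using z by (intro mult_right_mono) auto
  then have "cmod (- of_real z * exp (- (v * of_real z))) \<le> z * exp (- (d * z))"
    using z by (simp add: norm_mult norm_exp_eq_Re mult_left_mono)
  also have "\<dots> \<le> 1 / d"
    using exp_ge_add_one_self[of "d * z"] d z
    by (simp add: exp_minus field_simps del: exp_ge_add_one_self)
  finally show "cmod (- of_real z * exp (- (v * of_real z))) \<le> 1 / d" .
qed (use w in auto)

text \<open>
  Difference quotients are taken within the half-plane \<open>Re w > Re \<xi> / 2\<close>, a neighbourhood of \<open>\<xi>\<close>
  on which they have a common integrable bound; dominated convergence gives the derivative.
\<close>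
lemma laplace_transform_holomorphic:
  assumes f: "integrable lborel f" and f0: "\<And>z. z < 0 \<Longrightarrow> f z = 0"
  shows "laplace_transform f holomorphic_on {\<xi>. 0 < Re \<xi>}"
proof -
  have [measurable]: "f \<in> borel_measurable borel" using f by auto
  have "\<exists>D. (laplace_transform f has_field_derivative D) (at \<xi>)" if "0 < Re \<xi>" for \<xi>
  proof -
    let ?d = "Re \<xi> / 2"
    let ?S = "{w. ?d < Re w}"
    let ?q = "\<lambda>w z. (exp (- (w * of_real z)) - exp (- (\<xi> * of_real z))) / (w - \<xi>) * complex_of_real (f z)"
    let ?D = "LBINT z. (- of_real z * exp (- (\<xi> * of_real z))) * complex_of_real (f z)"
    have "((\<lambda>w. (laplace_transform f w - laplace_transform f \<xi>) / (w - \<xi>)) \<longlongrightarrow> ?D) (at \<xi> within ?S)"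
      unfolding tendsto_at_iff_sequentially comp_def
    proof (intro allI impI)
      fix X assume X: "\<forall>n. X n \<in> ?S - {\<xi>}" "X \<longlonglongrightarrow> \<xi>"
      have q: "(laplace_transform f (X n) - laplace_transform f \<xi>) / (X n - \<xi>) = (LBINT z. ?q (X n) z)" for n
      proof -
        have "0 \<le> Re (X n)" using X(1)[rule_format, of n] that by simp
        then have "laplace_transform f (X n) - laplace_transform f \<xi> =
            (LBINT z. (exp (- (X n * of_real z)) - exp (- (\<xi> * of_real z))) * complex_of_real (f z))"
          unfolding laplace_transform_def using that
          by (subst Bochner_Integration.integral_diff[symmetric])
             (auto intro!: integrable_laplace_integrand f f0 simp: left_diff_distrib)
        then show ?thesis
          by (simp flip: integral_divide_zero add: mult_ac)
      qed
      have "(\<lambda>n. LBINT z. ?q (X n) z) \<longlonglongrightarrow> ?D"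
      proof (rule integral_dominated_convergence)
        show "integrable lborel (\<lambda>z. 1 / ?d * \<bar>f z\<bar>)" using f by simp
        show "AE z in lborel. (\<lambda>n. ?q (X n) z) \<longlonglongrightarrow> (- of_real z * exp (- (\<xi> * of_real z))) * complex_of_real (f z)"
        proof (rule AE_I2)
          fix z
          have "((\<lambda>w. exp (- (w * of_real z))) has_field_derivative - of_real z * exp (- (\<xi> * of_real z))) (at \<xi> within ?S)"
            by (auto intro!: derivative_eq_intros)
          then have "(\<lambda>n. (exp (- (X n * of_real z)) - exp (- (\<xi> * of_real z))) / (X n - \<xi>)) \<longlonglongrightarrow>
              - of_real z * exp (- (\<xi> * of_real z))"
            using X unfolding has_field_derivative_iff tendsto_at_iff_sequentially comp_def by blast
          then show "(\<lambda>n. ?q (X n) z) \<longlonglongrightarrow> (- of_real z * exp (- (\<xi> * of_real z))) * complex_of_real (f z)"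
            by (intro tendsto_intros)
        qed
        show "AE z in lborel. cmod (?q (X n) z) \<le> 1 / ?d * \<bar>f z\<bar>" for n
        proof (rule AE_I2)
          fix z
          show "cmod (?q (X n) z) \<le> 1 / ?d * \<bar>f z\<bar>"
          proof (cases "z < 0")
            case False
            have "X n \<noteq> \<xi>" "?d \<le> Re (X n)" using X(1)[rule_format, of n] by auto
            then have "cmod ((exp (- (X n * of_real z)) - exp (- (\<xi> * of_real z))) / (X n - \<xi>)) \<le> 1 / ?d"
              using norm_exp_difference_le[of ?d "X n" \<xi> z] that False
              by (simp add: norm_divide divide_le_eq)
            from mult_right_mono[OF this, of "\<bar>f z\<bar>"] show ?thesis
              unfolding norm_mult norm_of_real by simp
          qed (use f0 in simp)
        qed
      qed measurable
      then show "(\<lambda>n. (laplace_transform f (X n) - laplace_transform f \<xi>) / (X n - \<xi>)) \<longlonglongrightarrow> ?D"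
        by (simp add: q)
    qed
    then have "(laplace_transform f has_field_derivative ?D) (at \<xi> within ?S)"
      by (simp add: has_field_derivative_iff)
    moreover have "open ?S" by (rule open_halfspace_Re_gt)
    ultimately show ?thesis using that at_within_open[of \<xi> ?S] by auto
  qed
  then show ?thesis
    by (auto simp: holomorphic_on_def field_differentiable_def intro: has_field_derivative_at_within)
qed

text \<open>
  Since \<open>\<alpha> < 1\<close>, the power maps the closed right half-plane into a sector strictly inside it. Hence
  \<open>\<mu> + \<xi>\<^sup>\<alpha>\<close> stays off the branch cut of the power with exponent \<open>-\<beta>\<close>.
\<close>
lemma Re_powr_pos:
  assumes "0 < \<alpha>" "\<alpha> < 1" "0 \<le> Re \<xi>" "\<xi> \<noteq> 0"
  shows "0 < Re (\<xi> powr of_real \<alpha>)"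
proof -
  have "\<bar>Im (Ln \<xi>)\<bar> \<le> pi / 2" using assms Re_Ln_pos_le by blast
  then have "\<bar>\<alpha> * Im (Ln \<xi>)\<bar> \<le> \<alpha> * (pi / 2)" using assms by (simp add: abs_mult mult_left_mono)
  also have "\<dots> < pi / 2" using assms by simp
  finally have "0 < cos (\<alpha> * Im (Ln \<xi>))" by (intro cos_gt_zero_pi) auto
  then show ?thesis using assms by (simp add: powr_def Re_exp)
qed

text \<open>
  The identity theorem carries the formula from the positive reals to the open half-plane, and the
  points \<open>\<xi> + 1/(n + 1)\<close> carry it to the boundary. The origin is left out because the complex power
  is not analytic there.
\<close>
lemma laplace_transform_eq_powr_if_eq_on_reals:
  assumes \<alpha>: "0 < \<alpha>" "\<alpha> < 1" and \<mu>: "0 < \<mu>"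
    and f: "integrable lborel f" and f0: "\<And>z. z < 0 \<Longrightarrow> f z = 0"
    and real: "\<And>x. x > 0 \<Longrightarrow> (LBINT z. exp (- (x * z)) * f z) = (\<mu> + x powr \<alpha>) powr - \<beta>"
    and Re: "0 \<le> Re \<xi>" "\<xi> \<noteq> 0"
  shows "laplace_transform f \<xi> = (of_real \<mu> + \<xi> powr of_real \<alpha>) powr - of_real \<beta>"
proof -
  let ?S = "{\<xi>::complex. 0 < Re \<xi>}"
  let ?g = "\<lambda>\<xi>. (of_real \<mu> + \<xi> powr of_real \<alpha>) powr - of_real \<beta> :: complex"
  have base: "of_real \<mu> + \<xi> powr of_real \<alpha> \<notin> \<real>\<^sub>\<le>\<^sub>0" if "0 \<le> Re \<xi>" "\<xi> \<noteq> 0" for \<xi>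
    using Re_powr_pos[OF \<alpha> that] \<mu> by (auto simp: complex_nonpos_Reals_iff)
  have cut: "\<xi> \<notin> \<real>\<^sub>\<le>\<^sub>0" if "0 \<le> Re \<xi>" "\<xi> \<noteq> 0" for \<xi> :: complex
    using that by (auto simp: complex_nonpos_Reals_iff complex_eq_iff)
  have interior: "laplace_transform f w = ?g w" if w: "w \<in> ?S" for w
  proof -
    let ?U = "complex_of_real ` {0<..}"
    have "laplace_transform f w - ?g w = 0"
    proof (rule analytic_continuation[where S = ?S and U = ?U and \<xi> = 1 and f = "\<lambda>w. laplace_transform f w - ?g w"])
      show "(\<lambda>w. laplace_transform f w - ?g w) holomorphic_on ?S"
      proof (intro holomorphic_intros laplace_transform_holomorphic f f0)
        fix w :: complex assume "w \<in> ?S"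
        then have "0 \<le> Re w" "w \<noteq> 0" by auto
        then show "w \<notin> \<real>\<^sub>\<le>\<^sub>0" "of_real \<mu> + w powr of_real \<alpha> \<notin> \<real>\<^sub>\<le>\<^sub>0" by (rule cut base)+
      qed
      show "open ?S" by (rule open_halfspace_Re_gt)
      show "connected ?S" by (rule convex_connected[OF convex_halfspace_Re_gt])
      show "1 islimpt ?U"
        unfolding islimpt_sequential
      proof (intro exI conjI allI)
        have gt1: "complex_of_real x \<in> ?U - {1}" if "1 < x" for x
          using that by auto
        show "complex_of_real (1 + inverse (real (Suc n))) \<in> ?U - {1}" for n
          by (rule gt1) (simp del: of_nat_Suc)
        have "(\<lambda>n. complex_of_real (1 + inverse (real (Suc n)))) \<longlonglongrightarrow> complex_of_real (1 + 0)"
          by (intro tendsto_intros LIMSEQ_inverse_real_of_nat)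
        then show "(\<lambda>n. complex_of_real (1 + inverse (real (Suc n)))) \<longlonglongrightarrow> 1" by simp
      qed
      fix v assume "v \<in> ?U"
      then obtain x where x: "v = of_real x" "x > 0" by auto
      have "laplace_transform f v = (LBINT z. complex_of_real (exp (- (x * z)) * f z))"
        unfolding laplace_transform_def x by (simp add: exp_of_real[symmetric] del: exp_of_real)
      also have "\<dots> = of_real ((\<mu> + x powr \<alpha>) powr - \<beta>)"
        unfolding integral_complex_of_real real[OF x(2)] ..
      also have "\<dots> = ?g v"
        using x \<mu> by (simp add: powr_of_real flip: of_real_add of_real_minus)
      finally show "laplace_transform f v - ?g v = 0" by simp
    qed (use w in auto)
    then show ?thesis by simp
  qed
  let ?X = "\<lambda>n. \<xi> + of_real (inverse (real (Suc n)))"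
  have X: "?X \<longlonglongrightarrow> \<xi>"
    using tendsto_add[OF tendsto_const tendsto_of_real[OF LIMSEQ_inverse_real_of_nat], of \<xi>] by simp
  have pos: "0 < Re (?X n)" for n
  proof -
    have "0 < inverse (real (Suc n))" by simp
    moreover have "Re (?X n) = Re \<xi> + inverse (real (Suc n))"
      by (simp only: plus_complex.sel Re_complex_of_real)
    ultimately show ?thesis using Re by linarith
  qed
  have "(\<lambda>n. laplace_transform f (?X n)) \<longlonglongrightarrow> laplace_transform f \<xi>"
    by (rule laplace_transform_sequentially_continuous[OF f f0 X]) (use pos in \<open>auto intro: less_imp_le\<close>)
  moreover have "isCont ?g \<xi>"
    using base[OF Re] cut[OF Re] by (intro continuous_intros) auto
  then have "(\<lambda>n. ?g (?X n)) \<longlonglongrightarrow> ?g \<xi>" by (rule isCont_tendsto_compose[OF _ X])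
  then have "(\<lambda>n. laplace_transform f (?X n)) \<longlonglongrightarrow> ?g \<xi>" using interior pos by simp
  ultimately show ?thesis by (rule LIMSEQ_unique)
qed

text \<open>
  The law of cosines for \<open>\<mu>\<close> and \<open>(-i\<tau>)\<^sup>\<alpha> = \<bar>\<tau>\<bar>\<^sup>\<alpha> exp(i\<theta>)\<close> with \<open>\<theta> = \<plusminus>\<pi>\<alpha>/2\<close>; the sign, opposite
  to that of \<open>\<tau>\<close>, disappears in the cosine.
\<close>
lemma norm_mu_plus_powr_imaginary:
  assumes "\<mu> > 0" "\<tau> \<noteq> 0"
  shows "(cmod (of_real \<mu> + (- \<i> * of_real \<tau>) powr of_real \<alpha>))\<^sup>2 =
    \<mu>\<^sup>2 + 2 * \<bar>\<tau>\<bar> powr \<alpha> * \<mu> * cos (pi * \<alpha> / 2) + \<bar>\<tau>\<bar> powr (2 * \<alpha>)"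
proof -
  define r where "r = \<bar>\<tau>\<bar> powr \<alpha>"
  define \<theta> where "\<theta> = \<alpha> * Im (Ln (- \<i> * of_real \<tau>))"
  have Im: "Im (Ln (- \<i> * of_real \<tau>)) = (if \<tau> > 0 then - pi / 2 else pi / 2)"
  proof (cases "\<tau> > 0")
    case True
    have "Ln (- \<i> * of_real \<tau>) = ln \<tau> + Ln (- \<i>)"
      using Ln_times_of_real[of \<tau> "- \<i>"] True by (simp add: mult.commute Ln_of_real)
    then show ?thesis using True by simp
  next
    case False
    then have "Ln (- complex_of_real \<tau>) = of_real (ln (- \<tau>))"
      using Ln_of_real[of "- \<tau>"] assms by simp
    then have "Ln (- \<i> * of_real \<tau>) = ln (- \<tau>) + Ln \<i>"
      using Ln_times_of_real[of "- \<tau>" "\<i>"] False assms by (simp add: mult.commute)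
    then show ?thesis using False by simp
  qed
  have cos: "cos \<theta> = cos (pi * \<alpha> / 2)"
    unfolding \<theta>_def Im by (cases "\<tau> > 0") (auto simp: mult.commute)
  have "(- \<i> * of_real \<tau>) powr of_real \<alpha> = of_real r * exp (\<i> * of_real \<theta>)"
    using assms by (simp add: powr_def exp_eq_polar Re_exp Im_exp r_def \<theta>_def complex_eq_iff norm_mult cis.sel)
  then have "(cmod (of_real \<mu> + (- \<i> * of_real \<tau>) powr of_real \<alpha>))\<^sup>2 = (\<mu> + r * cos \<theta>)\<^sup>2 + (r * sin \<theta>)\<^sup>2"
    by (simp add: cmod_power2 Re_exp Im_exp)
  also have "\<dots> = \<mu>\<^sup>2 + 2 * r * \<mu> * cos \<theta> + r\<^sup>2 * ((cos \<theta>)\<^sup>2 + (sin \<theta>)\<^sup>2)"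
    by (simp only: power_mult_distrib power2_sum distrib_left mult_ac add_ac)
  also have "\<dots> = \<mu>\<^sup>2 + 2 * r * \<mu> * cos \<theta> + r\<^sup>2" by simp
  also have "r\<^sup>2 = \<bar>\<tau>\<bar> powr (2 * \<alpha>)"
    by (simp add: r_def power2_eq_square flip: powr_add)
  finally show ?thesis by (simp add: cos r_def)
qed

section \<open>The kernel of the subordinated process\<close>

text \<open>
  Euler's integral after the scaling \<open>s \<mapsto> c s\<close>.
\<close>
lemma has_bochner_integral_Gamma:
  assumes "\<beta> > 0" "c > (0::real)"
  shows "has_bochner_integral lborel (\<lambda>s. indicator {0<..} s * (s powr (\<beta> - 1) * exp (- (c * s)))) (Gamma \<beta> * c powr - \<beta>)"
proof -
  let ?f = "\<lambda>s. indicator {0<..} s * (s powr (\<beta> - 1) * exp (- s)) :: real"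
  have "(\<integral>\<^sup>+ s. ennreal (?f s) \<partial>lborel) = (\<integral>\<^sup>+ t. ennreal (indicator {0..} t * t powr (\<beta> - 1) / exp t) \<partial>lborel)"
    by (intro nn_integral_cong arg_cong[where f = ennreal]) (auto simp: indicator_def exp_minus field_simps)
  also have "\<dots> = ennreal (Gamma \<beta>)"
    by (rule Gamma_conv_nn_integral_real[OF assms(1), symmetric])
  finally have "has_bochner_integral lborel ?f (Gamma \<beta>)"
    using assms by (intro has_bochner_integral_nn_integral) (auto simp: less_imp_le)
  then have "has_bochner_integral lborel (\<lambda>s. ?f (0 + c * s)) (Gamma \<beta> /\<^sub>R \<bar>c\<bar>)"
    using assms(2) by (subst (asm) lborel_has_bochner_integral_real_affine_iff[of c _ _ 0]) auto
  then have "has_bochner_integral lborel (\<lambda>s. c powr (1 - \<beta>) * ?f (0 + c * s)) (c powr (1 - \<beta>) * (Gamma \<beta> /\<^sub>R \<bar>c\<bar>))"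
    by (intro has_bochner_integral_mult_right)
  also have "(\<lambda>s. c powr (1 - \<beta>) * ?f (0 + c * s)) = (\<lambda>s. indicator {0<..} s * (s powr (\<beta> - 1) * exp (- (c * s))))"
  proof
    fix s
    show "c powr (1 - \<beta>) * ?f (0 + c * s) = indicator {0<..} s * (s powr (\<beta> - 1) * exp (- (c * s)))"
      using assms(2) by (auto simp: indicator_def zero_less_mult_iff powr_mult powr_diff powr_minus field_simps)
  qed
  also have "c powr (1 - \<beta>) * (Gamma \<beta> /\<^sub>R \<bar>c\<bar>) = Gamma \<beta> * c powr - \<beta>"
    using assms(2) by (simp add: powr_diff powr_minus field_simps)
  finally show ?thesis .
qed

lemma powr_minus_squared: "0 \<le> x \<Longrightarrow> (x powr - b)\<^sup>2 = 1 / x\<^sup>2 powr b" for x b :: real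
  by (simp add: power2_eq_square powr_mult powr_minus_divide)

text \<open>
  A density is meaningful only on \<open>z \<ge> 0\<close>, \<open>s > 0\<close>. Extending it by 0 gives a Borel function on the whole
  plane, to which the product measure theorems apply.
\<close>
definition zero_extension :: "(real \<Rightarrow> real \<Rightarrow> real) \<Rightarrow> real \<Rightarrow> real \<Rightarrow> real" where
  "zero_extension h z s = (if 0 \<le> z \<and> 0 < s then h z s else 0)"

context
  fixes \<alpha> :: real and h :: "real \<Rightarrow> real \<Rightarrow> real"
  assumes h: "stable_subordinator_density \<alpha> h"
begin

lemma zero_extension_measurable:
  "(\<lambda>(z, s). zero_extension h z s) \<in> borel_measurable (borel \<Otimes>\<^sub>M borel)"
proof -
  have "(\<lambda>x. indicator ({0..} \<times> {0<..}) x *\<^sub>R (\<lambda>(z, s). h z s) x) \<in> borel_measurable (borel :: (real \<times> real) measure)"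
    using h by (subst borel_measurable_restrict_space_iff[symmetric])
      (auto simp: stable_subordinator_density_def intro!: borel_Times)
  also have "(\<lambda>x. indicator ({0..} \<times> {0<..}) x *\<^sub>R (\<lambda>(z, s). h z s) x) = (\<lambda>(z, s). zero_extension h z s)"
    by (auto simp: zero_extension_def fun_eq_iff indicator_def)
  finally show ?thesis by (simp add: borel_prod)
qed

lemma zero_extension_nonneg: "0 \<le> zero_extension h z s"
  using h by (auto simp: zero_extension_def stable_subordinator_density_def)

lemma integrable_if_integral_nonzero:
  "integral\<^sup>L M f = c \<Longrightarrow> c \<noteq> 0 \<Longrightarrow> integrable M f"
  using not_integrable_integral_eq by blast

lemma integral_exp_zero_extension:
  assumes "0 < s" "0 \<le> \<xi>"
  shows "has_bochner_integral lborel (\<lambda>z. exp (- (\<xi> * z)) * zero_extension h z s) (exp (- (s * \<xi> powr \<alpha>)))"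
proof -
  have "(LBINT z:{0..}. exp (- \<xi> * z) * h z s) = exp (- s * \<xi> powr \<alpha>)"
    using h assms by (simp add: stable_subordinator_density_def)
  also have "(LBINT z:{0..}. exp (- \<xi> * z) * h z s) = (LBINT z. exp (- (\<xi> * z)) * zero_extension h z s)"
    unfolding set_lebesgue_integral_def using assms
    by (intro Bochner_Integration.integral_cong) (auto simp: zero_extension_def indicator_def)
  finally have eq: "(LBINT z. exp (- (\<xi> * z)) * zero_extension h z s) = exp (- (s * \<xi> powr \<alpha>))" by simp
  then have "integrable lborel (\<lambda>z. exp (- (\<xi> * z)) * zero_extension h z s)"
    by (rule integrable_if_integral_nonzero) simp
  with eq show ?thesis by (simp add: has_bochner_integral_iff)
qed

lemma subordinated_kernel_eq:
  "subordinated_kernel h \<beta> \<mu> z =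
    (LBINT s. s powr (\<beta> - 1) * exp (- (s * \<mu>)) * zero_extension h z s) / Gamma \<beta>"
proof (cases "z < 0")
  case False
  have "(LBINT s:{0<..}. s powr (\<beta> - 1) * exp (- s * \<mu>) * h z s) =
      (LBINT s. s powr (\<beta> - 1) * exp (- (s * \<mu>)) * zero_extension h z s)"
    unfolding set_lebesgue_integral_def using False
    by (intro Bochner_Integration.integral_cong) (auto simp: zero_extension_def indicator_def)
  then show ?thesis using False by (simp add: subordinated_kernel_def)
qed (simp add: subordinated_kernel_def zero_extension_def)

text \<open>
  By Tonelli the integrals over \<open>z\<close> and \<open>s\<close> may be exchanged. The inner integral is then
  \<open>exp(-s \<xi>\<^sup>\<alpha>)\<close>, which turns the outer one into a Gamma integral with rate \<open>\<mu> + \<xi>\<^sup>\<alpha>\<close>. The case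
  \<open>\<xi> = 0\<close> also gives the integrability of the kernel.
\<close>
lemma subordinated_kernel_laplace:
  assumes \<beta>: "0 < \<beta>" and \<mu>: "0 < \<mu>" and \<xi>: "0 \<le> \<xi>"
  shows "integrable lborel (\<lambda>z. exp (- (\<xi> * z)) * subordinated_kernel h \<beta> \<mu> z)"
    and "(LBINT z. exp (- (\<xi> * z)) * subordinated_kernel h \<beta> \<mu> z) = (\<mu> + \<xi> powr \<alpha>) powr - \<beta>"
proof -
  define G where "G = (\<lambda>s z. s powr (\<beta> - 1) * exp (- (s * \<mu>)) * (exp (- (\<xi> * z)) * zero_extension h z s))"
  define c where "c = \<mu> + \<xi> powr \<alpha>"
  have c: "0 < c" using \<mu> by (simp add: c_def add_pos_nonneg)
  have swapped [measurable]: "(\<lambda>(s, z). zero_extension h z s) \<in> borel_measurable (borel \<Otimes>\<^sub>M borel)"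
    using measurable_compose[OF measurable_pair_swap' zero_extension_measurable] by (simp add: split_beta')
  have inner: "has_bochner_integral lborel (\<lambda>z. G s z) (indicator {0<..} s * (s powr (\<beta> - 1) * exp (- (c * s))))" for s
  proof (cases "0 < s")
    case True
    have "has_bochner_integral lborel (\<lambda>z. G s z) (s powr (\<beta> - 1) * exp (- (s * \<mu>)) * exp (- (s * \<xi> powr \<alpha>)))"
      unfolding G_def by (intro has_bochner_integral_mult_right integral_exp_zero_extension True \<xi>)
    also have "s powr (\<beta> - 1) * exp (- (s * \<mu>)) * exp (- (s * \<xi> powr \<alpha>)) = s powr (\<beta> - 1) * exp (- (c * s))"
      unfolding mult.assoc exp_add[symmetric] by (simp add: c_def algebra_simps)
    finally show ?thesis using True by simp
  qed (simp add: G_def zero_extension_def has_bochner_integral_zero)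
  have nonneg: "norm (G s z) = G s z" for s z using zero_extension_nonneg by (simp add: G_def)
  note gamma = has_bochner_integral_Gamma[OF \<beta> c]
  have outer: "(LBINT z. G s z) = indicator {0<..} s * (s powr (\<beta> - 1) * exp (- (c * s)))" for s
    using inner by (rule has_bochner_integral_integral_eq)
  have int: "integrable (lborel \<Otimes>\<^sub>M lborel) (\<lambda>(s, z). G s z)"
  proof (rule lborel_pair.Fubini_integrable)
    show "(\<lambda>(s, z). G s z) \<in> borel_measurable (lborel \<Otimes>\<^sub>M lborel)"
      using swapped unfolding G_def split_beta' by measurable
    show "AE s in lborel. integrable lborel (\<lambda>z. case (s, z) of (s, z) \<Rightarrow> G s z)"
      using inner by (auto intro: integrable.intros)
    show "integrable lborel (\<lambda>s. LBINT z. norm (case (s, z) of (s, z) \<Rightarrow> G s z))"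
      unfolding prod.case nonneg outer using gamma by (rule integrable.intros)
  qed
  have kernel: "exp (- (\<xi> * z)) * subordinated_kernel h \<beta> \<mu> z = (LBINT s. G s z) / Gamma \<beta>" for z
  proof -
    have "(LBINT s. G s z) = (LBINT s. exp (- (\<xi> * z)) * (s powr (\<beta> - 1) * exp (- (s * \<mu>)) * zero_extension h z s))"
      by (simp add: G_def mult_ac)
    then show ?thesis unfolding subordinated_kernel_eq integral_mult_right_zero by simp
  qed
  show "integrable lborel (\<lambda>z. exp (- (\<xi> * z)) * subordinated_kernel h \<beta> \<mu> z)"
    unfolding kernel using lborel_pair.integrable_snd[OF int] by simp
  have "(LBINT z. exp (- (\<xi> * z)) * subordinated_kernel h \<beta> \<mu> z) = (LBINT z. LBINT s. G s z) / Gamma \<beta>"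
    unfolding kernel by simp
  also have "\<dots> = (LBINT s. LBINT z. G s z) / Gamma \<beta>"
    unfolding lborel_pair.Fubini_integral[OF int] ..
  also have "\<dots> = c powr - \<beta>"
    unfolding outer has_bochner_integral_integral_eq[OF gamma] using \<beta> by (simp add: Gamma_real_pos less_imp_neq[symmetric])
  finally show "(LBINT z. exp (- (\<xi> * z)) * subordinated_kernel h \<beta> \<mu> z) = (\<mu> + \<xi> powr \<alpha>) powr - \<beta>"
    by (simp add: c_def)
qed

lemma integrable_subordinated_kernel:
  "0 < \<beta> \<Longrightarrow> 0 < \<mu> \<Longrightarrow> integrable lborel (subordinated_kernel h \<beta> \<mu>)"
  using subordinated_kernel_laplace(1)[of \<beta> \<mu> 0] by simp

text \<open>
  At \<open>\<tau> \<noteq> 0\<close> this is the modulus of the continued Laplace transform at \<open>-i\<tau>\<close>. At \<open>\<tau> = 0\<close>, which the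
  continuation does not reach, it is the total mass of the kernel.
\<close>
lemma norm_fourier_subordinated_kernel:
  assumes \<alpha>: "0 < \<alpha>" "\<alpha> < 1" and \<beta>: "0 < \<beta>" and \<mu>: "0 < \<mu>"
  shows "(cmod (LBINT z. exp (\<i> * of_real (\<tau> * z)) * complex_of_real (subordinated_kernel h \<beta> \<mu> z)))\<^sup>2 =
    1 / (\<mu>\<^sup>2 + 2 * \<bar>\<tau>\<bar> powr \<alpha> * \<mu> * cos (pi * \<alpha> / 2) + \<bar>\<tau>\<bar> powr (2 * \<alpha>)) powr \<beta>"
proof (cases "\<tau> = 0")
  case True
  have "(LBINT z. subordinated_kernel h \<beta> \<mu> z) = \<mu> powr - \<beta>"
    using subordinated_kernel_laplace(2)[OF \<beta> \<mu>, of 0] by simp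
  then show ?thesis
    using True \<mu> by (simp add: powr_minus_squared norm_of_real del: of_real_power)
next
  case False
  let ?b = "of_real \<mu> + (- \<i> * of_real \<tau>) powr of_real \<alpha>"
  have "(LBINT z. exp (\<i> * of_real (\<tau> * z)) * complex_of_real (subordinated_kernel h \<beta> \<mu> z)) =
      laplace_transform (subordinated_kernel h \<beta> \<mu>) (- \<i> * of_real \<tau>)"
    by (simp add: laplace_transform_def mult.assoc)
  also have "\<dots> = ?b powr - of_real \<beta>"
    by (rule laplace_transform_eq_powr_if_eq_on_reals[OF \<alpha> \<mu> integrable_subordinated_kernel[OF \<beta> \<mu>]])
       (use False subordinated_kernel_laplace(2)[OF \<beta> \<mu>] in \<open>auto simp: subordinated_kernel_def\<close>)
  also have "cmod \<dots> = cmod ?b powr - \<beta>"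
    using norm_powr_real_powr'[of "- of_real \<beta>" ?b] by simp
  finally have "(cmod (LBINT z. exp (\<i> * of_real (\<tau> * z)) * complex_of_real (subordinated_kernel h \<beta> \<mu> z)))\<^sup>2 =
      (cmod ?b powr - \<beta>)\<^sup>2" by simp
  also have "\<dots> = 1 / (cmod ?b)\<^sup>2 powr \<beta>"
    by (rule powr_minus_squared) simp
  finally show ?thesis
    unfolding norm_mu_plus_powr_imaginary[OF \<mu> False] .
qed

end

section \<open>The spectral density\<close>

theorem theorem2p2:
  fixes \<alpha> \<beta> \<mu> \<sigma> :: real
    and h :: "real \<Rightarrow> real \<Rightarrow> real"
    and M :: "'w measure"
    and W :: "(real \<Rightarrow> real) \<Rightarrow> 'w \<Rightarrow> real"
    and K :: "real \<Rightarrow> real"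
    and X :: "(real \<Rightarrow> real) \<Rightarrow> 'w \<Rightarrow> real"
  assumes "0 < \<alpha>" and "\<alpha> < 1" and "\<beta> > 0" and "\<mu> > 0"
    and "stable_subordinator_density \<alpha> h"
    and "white_noise M \<sigma> W"
    and K_eq: "K = subordinated_kernel h \<beta> \<mu>"
    and X_eq: "X = moving_average W K"
  shows "integrable lborel K \<and>
    (\<exists>C. is_covariance_function M X C) \<and>
    (\<forall>C. is_covariance_function M X C \<longrightarrow>
      (\<forall>\<tau>. spectral_density_of C \<tau> =
        of_real (\<sigma>\<^sup>2 /
          (\<mu>\<^sup>2 + 2 * \<bar>\<tau>\<bar> powr \<alpha> * \<mu> * cos (pi * \<alpha> / 2) + \<bar>\<tau>\<bar> powr (2 * \<alpha>)) powr \<beta>)))"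
proof -
  note h = \<open>stable_subordinator_density \<alpha> h\<close> and W = \<open>white_noise M \<sigma> W\<close>
  have K: "integrable lborel K"
    unfolding K_eq using integrable_subordinated_kernel[OF h \<open>\<beta> > 0\<close> \<open>\<mu> > 0\<close>] .
  moreover have "is_covariance_function M X (\<lambda>h. \<sigma>\<^sup>2 * autocorrelation K h)"
    unfolding X_eq by (rule is_covariance_function_moving_average[OF W K])
  moreover have "spectral_density_of C \<tau> = of_real (\<sigma>\<^sup>2 /
      (\<mu>\<^sup>2 + 2 * \<bar>\<tau>\<bar> powr \<alpha> * \<mu> * cos (pi * \<alpha> / 2) + \<bar>\<tau>\<bar> powr (2 * \<alpha>)) powr \<beta>)"
    if "is_covariance_function M X C" for C \<tau>
    using spectral_density_moving_average[OF W K that[unfolded X_eq], of \<tau>]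
    unfolding K_eq norm_fourier_subordinated_kernel[OF h assms(1-4)] by simp
  ultimately show ?thesis by blast
qed

end
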